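(* Let $G_o$ be a non-compact unimodular lcsc group acting jointly continuously on a Polish space $X$, let $Z\subset X$ be a separated cross section with return time set $\Lambda$, and let $\mu$ be a $G_o$-invariant Borel probability measure on $X$ with transverse measure $\nu$ on $Z$. If $\Lambda$ is a uniform approximate lattice in $G_o$, then the action of $G_o$ on $X$ is $r$-fold transversally recurrent for every $r\in\mathbb N$; that is, for every $r\in \mathbb N$ and for $\nu^{\otimes r}$-almost every $(z_1,\dots,z_r)\in Z^r$ there exists a sequence $(g_n)$ in $G_o$ such that $g_n\to\infty$ and, for all $j\in\{1,\dots,r\}$, $g_n.z_j\in Z$ for all $n$ and $g_n.z_j\to z_j$.
   Context: lcsc = locally compact second countable; $m_{G_o}$ is a fixed Haar measure on $G_o$; $g_n\to\infty$ means that $(g_n)$ eventually leaves every compact set. A Borel set $Z\subset X$ is a cross section if $G_o.Z=X$; its return time set is $\Lambda:=\{g\in G_o: g.Z\cap Z\neq\emptyset\}$; $Z$ is separated if $\Lambda\cap U=\{e\}$ for some identity neighbourhood $U$. For $x\in X$ put $Z_x:=\{g\in G_o: g.x\in Z\}$. The transverse measure of $\mu$ is the unique finite Borel measure $\nu$ on $Z$ such that for all bounded non-negative Borel $f:G_o\times Z\to\mathbb R$, $$\int_X\sum_{g\in Z_x}f(g^{-1},g.x)\,d\mu(x)=\int_{G_o}\int_Z f(g,z)\,d\nu(z)\,dm_{G_o}(g).$$ A uniform approximate lattice in $G_o$ is a symmetric subset $\Lambda\ni e$ such that $\Lambda^2\subset\Lambda F$ for some finite $F\subset G_o$, $\Lambda$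 is uniformly discrete ($\Lambda\Lambda^{-1}\cap U=\{e\}$ for some identity neighbourhood $U$) and $G_o=K\Lambda$ for some compact $K$. *)

theory Defs
  imports "HOL-Probability.Probability"
begin

text \<open>
  The group is an instance of \<^class>\<open>topological_group_add\<close>. This class does not
  assume commutativity: \<open>g + h\<close>, \<open>- g\<close>, \<open>0\<close> and \<open>g - h = g + (- h)\<close> stand for
  \<open>g h\<close>, \<open>g\<inverse>\<close>, \<open>e\<close> and \<open>g h\<inverse>\<close>, and \<open>A + B\<close> is the product set \<open>A B\<close>.
\<close>

definition lcsc_group :: "'g::{topological_group_add, t2_space, second_countable_topology} itself \<Rightarrow> bool"
  where "lcsc_group _ \<longleftrightarrow> locally_compact_space (euclidean :: 'g topology)"

text \<open>
  On a locally compact second countable group, a Borel measure that is finite on compact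
  sets is automatically regular, so regularity is not part of the definition.
\<close>

definition left_haar_measure :: "'g::topological_group_add measure \<Rightarrow> bool"
  where "left_haar_measure m \<longleftrightarrow>
    sets m = sets borel \<and>
    emeasure m UNIV \<noteq> 0 \<and>
    (\<forall>K. compact K \<longrightarrow> emeasure m K < \<infinity>) \<and>
    (\<forall>g. \<forall>A\<in>sets borel. emeasure m ((\<lambda>h. g + h) ` A) = emeasure m A)"

definition unimodular_group :: "'g::topological_group_add itself \<Rightarrow> bool"
  where "unimodular_group _ \<longleftrightarrow>
    (\<forall>m :: 'g measure. left_haar_measure m \<longrightarrow>
       (\<forall>g. \<forall>A\<in>sets borel. emeasure m ((\<lambda>h. h + g) ` A) = emeasure m A))"

definition tends_to_group_infinity :: "(nat \<Rightarrow> 'g::topological_space) \<Rightarrow> bool"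
  where "tends_to_group_infinity g \<longleftrightarrow>
    (\<forall>K. compact K \<longrightarrow> (\<forall>\<^sub>F n in sequentially. g n \<notin> K))"

definition jointly_continuous_action ::
    "('g::topological_group_add \<Rightarrow> 'x::topological_space \<Rightarrow> 'x) \<Rightarrow> bool"
  where "jointly_continuous_action act \<longleftrightarrow>
    (\<forall>x. act 0 x = x) \<and>
    (\<forall>g h x. act (g + h) x = act g (act h x)) \<and>
    continuous_on UNIV (\<lambda>(g, x). act g x)"

definition invariant_prob_measure ::
    "('g \<Rightarrow> 'x::topological_space \<Rightarrow> 'x) \<Rightarrow> 'x measure \<Rightarrow> bool"
  where "invariant_prob_measure act \<mu> \<longleftrightarrow>
    prob_space \<mu> \<and> sets \<mu> = sets borel \<and> (\<forall>g. distr \<mu> borel (act g) = \<mu>)"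

definition cross_section :: "('g \<Rightarrow> 'x::topological_space \<Rightarrow> 'x) \<Rightarrow> 'x set \<Rightarrow> bool"
  where "cross_section act Z \<longleftrightarrow> Z \<in> sets borel \<and> (\<Union>g. act g ` Z) = UNIV"

definition return_times :: "('g \<Rightarrow> 'x \<Rightarrow> 'x) \<Rightarrow> 'x set \<Rightarrow> 'g set"
  where "return_times act Z = {g. act g ` Z \<inter> Z \<noteq> {}}"

definition separated :: "('g::topological_group_add \<Rightarrow> 'x \<Rightarrow> 'x) \<Rightarrow> 'x set \<Rightarrow> bool"
  where "separated act Z \<longleftrightarrow>
    (\<exists>U. open U \<and> 0 \<in> U \<and> return_times act Z \<inter> U = {0})"

definition hitting_times :: "('g \<Rightarrow> 'x \<Rightarrow> 'x) \<Rightarrow> 'x set \<Rightarrow> 'x \<Rightarrow> 'g set"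
  where "hitting_times act Z x = {g. act g x \<in> Z}"

text \<open>
  The test functions \<open>f\<close> are total, but only their values on \<open>UNIV \<times> Z\<close> matter, both in
  the conditions on \<open>f\<close> and in the integral identity. Both sides are taken in
  \<^typ>\<open>ennreal\<close>, i.e. infinite values are allowed.
\<close>

definition transverse_measure ::
    "'g::topological_group_add measure \<Rightarrow> ('g \<Rightarrow> 'x::topological_space \<Rightarrow> 'x) \<Rightarrow> 'x set
      \<Rightarrow> 'x measure \<Rightarrow> 'x measure \<Rightarrow> bool"
  where "transverse_measure m act Z \<mu> \<nu> \<longleftrightarrow>
    sets \<nu> = sets (restrict_space borel Z) \<and>
    finite_measure \<nu> \<and>
    (\<forall>f :: 'g \<times> 'x \<Rightarrow> real.
       f \<in> borel_measurable (restrict_space borel (UNIV \<times> Z)) \<longrightarrow>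
       (\<exists>C. \<forall>g. \<forall>z\<in>Z. 0 \<le> f (g, z) \<and> f (g, z) \<le> C) \<longrightarrow>
       (\<integral>\<^sup>+ x. (\<Sum>\<^sub>\<infinity> g \<in> hitting_times act Z x. ennreal (f (- g, act g x))) \<partial>\<mu>)
         = (\<integral>\<^sup>+ g. (\<integral>\<^sup>+ z. ennreal (f (g, z)) \<partial>\<nu>) \<partial>m))"

definition uniform_approximate_lattice :: "'g::topological_group_add set \<Rightarrow> bool"
  where "uniform_approximate_lattice \<Lambda> \<longleftrightarrow>
    0 \<in> \<Lambda> \<and> uminus ` \<Lambda> = \<Lambda> \<and>
    (\<exists>F. finite F \<and> \<Lambda> + \<Lambda> \<subseteq> \<Lambda> + F) \<and>
    (\<exists>U. open U \<and> 0 \<in> U \<and> {a - b | a b. a \<in> \<Lambda> \<and> b \<in> \<Lambda>} \<inter> U = {0}) \<and>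
    (\<exists>K. compact K \<and> K + \<Lambda> = UNIV)"

definition transversally_recurrent ::
    "('g::topological_space \<Rightarrow> 'x::topological_space \<Rightarrow> 'x) \<Rightarrow> 'x set \<Rightarrow> 'x measure \<Rightarrow> nat \<Rightarrow> bool"
  where "transversally_recurrent act Z \<nu> r \<longleftrightarrow>
    (AE z in Pi\<^sub>M {1..r} (\<lambda>_. \<nu>).
       \<exists>g :: nat \<Rightarrow> 'g. tends_to_group_infinity g \<and>
         (\<forall>j\<in>{1..r}. (\<forall>n. act (g n) (z j) \<in> Z) \<and>
                     (\<lambda>n. act (g n) (z j)) \<longlonglongrightarrow> z j))"

end

theory Submission
  imports Defs
begin

text \<open>
  Since \<open>\<Lambda>\<^sup>3\<close> is contained in finitely many right translates of \<open>\<Lambda>\<close>, it meets \<open>V\<inverse>V\<close> only in \<open>e\<close>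
  for a small identity neighbourhood \<open>V\<close>. Let \<open>A \<subseteq> Z\<^sup>r\<close> be a set of positive measure whose points
  return to \<open>A\<close> under \<open>\<Lambda>\<inverse>\<Lambda>\<close> only within a compact set \<open>K\<close>. For \<open>\<lambda> \<in> \<Lambda>\<close> acting diagonally, the
  thickening \<open>V\<^sup>r\<lambda>A \<subseteq> X\<^sup>r\<close> is parametrised injectively and, by unimodularity, has
  \<open>\<mu>\<^sup>\<otimes>\<^sup>r\<close>-measure \<open>m(V)\<^sup>r \<nu>\<^sup>\<otimes>\<^sup>r(A)\<close>, which does not depend on \<open>\<lambda>\<close>. Two such thickenings can
  meet only if \<open>\<lambda>'\<inverse>\<lambda> \<in> K\<close>. As \<open>\<Lambda>\<close> is not relatively compact, arbitrarily many of them are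
  pairwise disjoint, which is impossible in a probability space. Countably many sets \<open>A\<close>,
  indexed by a compact exhaustion of the group and a basis of \<open>X\<close>, cover all points that are
  not recurrent.
\<close>

section \<open>Topological groups\<close>

lemma continuous_on_uminus_group:
  "continuous_on S (uminus :: 'g::topological_group_add \<Rightarrow> 'g)"
  unfolding continuous_on_def by (intro ballI tendsto_minus tendsto_ident_at)

lemma continuous_on_add_left:
  "continuous_on S (\<lambda>h. g + h :: 'g::topological_monoid_add)"
  by (intro continuous_intros)

lemma continuous_on_add_right:
  "continuous_on S (\<lambda>h. h + g :: 'g::topological_monoid_add)"
  by (intro continuous_intros)

lemma open_left_translate:
  fixes V :: "'g::topological_group_add set"
  assumes "open V"
  shows "open ((\<lambda>h. g + h) ` V)"
proof -
  have "(\<lambda>h. g + h) ` V = (\<lambda>h. - g + h) -` V"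
  proof (intro set_eqI iffI)
    show "x \<in> (\<lambda>h. g + h) ` V" if "x \<in> (\<lambda>h. - g + h) -` V" for x
      using that by (intro image_eqI[of _ _ "- g + x"]) auto
  qed auto
  then show ?thesis
    using open_vimage[OF assms continuous_on_add_left] by simp
qed

lemma open_right_translate:
  fixes V :: "'g::topological_group_add set"
  assumes "open V"
  shows "open ((\<lambda>h. h + g) ` V)"
proof -
  have "(\<lambda>h. h + g) ` V = (\<lambda>h. h + (- g)) -` V"
  proof (intro set_eqI iffI)
    show "x \<in> (\<lambda>h. h + g) ` V" if "x \<in> (\<lambda>h. h + (- g)) -` V" for x
      using that by (intro image_eqI[of _ _ "x + (- g)"]) auto
  qed auto
  then show ?thesis
    using open_vimage[OF assms continuous_on_add_right[of _ "- g"]] by simp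
qed

text \<open>Both difference maps are continuous and send \<open>(0, 0)\<close> to \<open>0\<close>,
  so a small square lies in both preimages of \<open>U\<close>. The group need not commute:
  \<open>a - b\<close> separates points of right translates of \<open>V\<close>, while
  \<open>- a + b\<close> separates points of left translates.\<close>

lemma open_zero_diff_subset:
  fixes U :: "'g::topological_group_add set"
  assumes "open U" "0 \<in> U"
  obtains V where "open V" "0 \<in> V" "\<And>a b. a \<in> V \<Longrightarrow> b \<in> V \<Longrightarrow> a - b \<in> U"
    "\<And>a b. a \<in> V \<Longrightarrow> b \<in> V \<Longrightarrow> - a + b \<in> U"
proof -
  let ?c = "\<lambda>(a, b). a - b :: 'g" and ?d = "\<lambda>(a, b). - a + b :: 'g"
  have c1: "continuous_on UNIV ?c"
    unfolding continuous_on_def case_prod_beta diff_conv_add_uminus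
    by (intro ballI tendsto_add tendsto_minus tendsto_fst tendsto_snd tendsto_ident_at)
  have c2: "continuous_on UNIV ?d"
    unfolding continuous_on_def case_prod_beta
    by (intro ballI tendsto_add tendsto_minus tendsto_fst tendsto_snd tendsto_ident_at)
  have "open (?c -` U \<inter> ?d -` U)" "(0, 0) \<in> ?c -` U \<inter> ?d -` U"
    using open_vimage[OF assms(1) c1] open_vimage[OF assms(1) c2] assms(2) by auto
  then obtain A B where AB: "open A" "open B" "(0, 0) \<in> A \<times> B"
      "A \<times> B \<subseteq> ?c -` U \<inter> ?d -` U"
    by (rule open_prod_elim)
  show ?thesis
    by (rule that[of "A \<inter> B"]) (use AB in auto)
qed

lemma compact_plus_group:
  fixes A B :: "'g::topological_monoid_add set"
  assumes "compact A" "compact B"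
  shows "compact (A + B)"
proof -
  have "A + B = (\<lambda>p. fst p + snd p) ` (A \<times> B)"
    by (fastforce simp: set_plus_def image_iff)
  moreover have "compact \<dots>"
    by (intro compact_continuous_image compact_Times assms continuous_intros)
  ultimately show ?thesis
    by simp
qed

section \<open>Compact exhaustions and Haar measure of open sets\<close>

text \<open>Every point has an open neighbourhood inside a compact set, and by Lindelof countably
  many of these neighbourhoods cover the group. The finite unions of the compact sets eventually
  swallow any compact set because it is already covered by finitely many of the open ones. A
  sequence with \<open>g n\<close> outside \<open>C n\<close> therefore tends to infinity.\<close>

lemma lcsc_compact_exhaustion:
  assumes "lcsc_group TYPE('g::{topological_group_add, t2_space, second_countable_topology})"
  obtains C :: "nat \<Rightarrow> 'g::{topological_group_add, t2_space, second_countable_topology} set"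
    where "\<And>n. compact (C n)"
    "\<And>K. compact K \<Longrightarrow> \<exists>N. \<forall>n\<ge>N. K \<subseteq> C n"
proof -
  have "\<exists>U K. open U \<and> compact K \<and> x \<in> U \<and> U \<subseteq> K" for x :: 'g
    using assms unfolding lcsc_group_def locally_compact_space_def by auto
  then obtain U K :: "'g \<Rightarrow> 'g set" where UK: "\<And>x. open (U x)" "\<And>x. compact (K x)" "\<And>x. x \<in> U x" "\<And>x. U x \<subseteq> K x"
    by metis
  obtain F where F: "F \<subseteq> range U" "countable F" "\<Union>F = \<Union>(range U)"
    using Lindelof[of "range U"] UK(1) by auto
  have "\<Union>F = UNIV" using F(3) UK(3) by auto
  then have "F \<noteq> {}" by auto
  define e where "e = from_nat_into F"
  have e: "range e = F"
    using F \<open>F \<noteq> {}\<close> unfolding e_def by simp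
  have "\<exists>x. e n = U x" for n
    using e F(1) by (metis image_iff rangeI subsetD)
  then obtain x where x: "\<And>n. e n = U (x n)" by metis
  show ?thesis
  proof (rule that[of "\<lambda>n. \<Union>i\<le>n. K (x i)"])
    show "compact (\<Union>i\<le>n. K (x i))" for n
      using UK(2) by (intro compact_UN) auto
    fix L :: "'g set" assume "compact L"
    moreover have "L \<subseteq> (\<Union>n\<in>UNIV. e n)" using e \<open>\<Union>F = UNIV\<close> by simp
    moreover have "\<And>n. n \<in> UNIV \<Longrightarrow> open (e n)" by (simp add: x UK(1))
    ultimately obtain I where I: "I \<subseteq> UNIV" "finite I" "L \<subseteq> (\<Union>n\<in>I. e n)"
      using compactE_image by metis
    obtain N where N: "\<And>i. i \<in> I \<Longrightarrow> i \<le> N"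
      using I(2) finite_nat_set_iff_bounded_le by auto
    have "L \<subseteq> (\<Union>i\<le>n. K (x i))" if "n \<ge> N" for n
    proof
      fix y assume "y \<in> L"
      then obtain i where "i \<in> I" "y \<in> e i" using I(3) by auto
      then show "y \<in> (\<Union>i\<le>n. K (x i))"
        using N[of i] UK(4)[of "x i"] x[of i] that by force
    qed
    then show "\<exists>N. \<forall>n\<ge>N. L \<subseteq> (\<Union>i\<le>n. K (x i))" by blast
  qed
qed

text \<open>Countably many left translates of \<open>V\<close> cover the group; if \<open>V\<close>
  were null, so would be the whole group.\<close>

lemma haar_open_pos:
  fixes V :: "'g::{topological_group_add, second_countable_topology} set"
  assumes "left_haar_measure m" "open V" "V \<noteq> {}"
  shows "emeasure m V > 0"
proof (rule ccontr)
  assume "\<not> emeasure m V > 0"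
  then have V0: "emeasure m V = 0" by simp
  have sets: "sets m = sets borel" and "emeasure m UNIV \<noteq> 0"
    and inv: "\<And>g A. A \<in> sets borel \<Longrightarrow> emeasure m ((\<lambda>h. g + h) ` A) = emeasure m A"
    using assms(1) unfolding left_haar_measure_def by auto
  let ?t = "\<lambda>g. (\<lambda>h. g + h) ` V"
  obtain F where F: "F \<subseteq> range ?t" "countable F" "\<Union>F = \<Union>(range ?t)"
    using Lindelof[of "range ?t"] open_left_translate[OF assms(2)] by blast
  obtain v where v: "v \<in> V" using assms(3) by auto
  have "x \<in> ?t (x - v)" for x using v by (intro image_eqI[of _ _ v]) auto
  then have U: "\<Union>F = UNIV" unfolding F(3) by blast
  have "emeasure m W = 0" if "W \<in> F" for W
    using that F(1) inv[of V] V0 assms(2) by auto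
  moreover have "W \<in> sets m" if "W \<in> F" for W
    using that F(1) open_left_translate[OF assms(2)] sets by auto
  ultimately have "\<And>W. W \<in> F \<Longrightarrow> W \<in> null_sets m" by (simp add: null_setsI)
  then have "\<Union>F \<in> null_sets m"
    using null_sets_UN'[of F "\<lambda>W. W" m] F(2) by auto
  with U \<open>emeasure m UNIV \<noteq> 0\<close> show False by (simp add: null_setsD1)
qed

section \<open>Uniform approximate lattices\<close>

text \<open>A right translate \<open>V + {g}\<close> holds at most one point of
  \<open>\<Lambda>\<close>, since two such points differ by an element of \<open>U\<close>.
  Countably many right translates cover the group.\<close>

lemma uniformly_discrete_countable:
  fixes \<Lambda> :: "'g::{topological_group_add, second_countable_topology} set"
  assumes "open U" "0 \<in> U" "{a - b | a b. a \<in> \<Lambda> \<and> b \<in> \<Lambda>} \<inter> U = {0}"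
  shows "countable \<Lambda>"
proof -
  obtain V where V: "open V" "0 \<in> V" "\<And>a b. a \<in> V \<Longrightarrow> b \<in> V \<Longrightarrow> a - b \<in> U"
    using open_zero_diff_subset[OF assms(1,2)] by metis
  let ?t = "\<lambda>g. (\<lambda>h. h + g) ` V"
  obtain F where F: "F \<subseteq> range ?t" "countable F" "\<Union>F = \<Union>(range ?t)"
    using Lindelof[of "range ?t"] open_right_translate[OF V(1)] by blast
  have "x \<in> ?t x" for x using V(2) by (intro image_eqI[of _ _ 0]) auto
  then have U: "\<Union>F = UNIV" unfolding F(3) by blast
  have "countable (\<Lambda> \<inter> W)" if W: "W \<in> F" for W
  proof -
    have "a = b" if ab: "a \<in> \<Lambda> \<inter> W" "b \<in> \<Lambda> \<inter> W" for a b
    proof -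
      obtain g where "W = ?t g" using W F(1) by auto
      then obtain v w where "v \<in> V" "w \<in> V" "a = v + g" "b = w + g" using ab by auto
      then have "a - b \<in> U" using V(3)[of v w] by (simp add: diff_add_eq_diff_diff_swap)
      then have "a - b \<in> {0}" using ab assms(3) by blast
      then show ?thesis by simp
    qed
    then have "\<exists>c. \<Lambda> \<inter> W \<subseteq> {c}" by blast
    then show ?thesis by (meson countable_finite finite.intros finite_subset)
  qed
  then have "countable (\<Union>W\<in>F. \<Lambda> \<inter> W)" using F(2) by blast
  moreover have "(\<Union>W\<in>F. \<Lambda> \<inter> W) = \<Lambda>" using U by auto
  ultimately show ?thesis by simp
qed

text \<open>Each translate of \<open>\<Lambda>\<close> by some \<open>e\<close> in \<open>E\<close>
  meets \<open>V\<close> in at most one point, so \<open>\<Lambda> + E\<close> meets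
  \<open>V\<close> in a finite set. Its nonzero points form a closed set that can be removed from
  \<open>V\<close>.\<close>

lemma uniformly_discrete_translates_isolated:
  fixes \<Lambda> :: "'g::{topological_group_add, t2_space} set"
  assumes "open U" "0 \<in> U" "{a - b | a b. a \<in> \<Lambda> \<and> b \<in> \<Lambda>} \<inter> U = {0}" "finite E"
  obtains W where "open W" "0 \<in> W" "(\<Lambda> + E) \<inter> W \<subseteq> {0}"
proof -
  obtain V where V: "open V" "0 \<in> V" "\<And>a b. a \<in> V \<Longrightarrow> b \<in> V \<Longrightarrow> a - b \<in> U"
    using open_zero_diff_subset[OF assms(1,2)] by metis
  have "finite {x \<in> V. \<exists>a\<in>\<Lambda>. x = a + e}" for e
  proof -
    have "x = y" if xy: "x \<in> {x \<in> V. \<exists>a\<in>\<Lambda>. x = a + e}" "y \<in> {x \<in> V. \<exists>a\<in>\<Lambda>. x = a + e}" for x y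
    proof -
      obtain a b where "a \<in> \<Lambda>" "b \<in> \<Lambda>" "x = a + e" "y = b + e" "x \<in> V" "y \<in> V" using xy by auto
      then have "a - b \<in> U" using V(3)[of x y] by (simp add: diff_add_eq_diff_diff_swap)
      then have "a - b \<in> {0}" using \<open>a \<in> \<Lambda>\<close> \<open>b \<in> \<Lambda>\<close> assms(3) by blast
      then show ?thesis using \<open>x = a + e\<close> \<open>y = b + e\<close> by simp
    qed
    then have "\<exists>c. {x \<in> V. \<exists>a\<in>\<Lambda>. x = a + e} \<subseteq> {c}" by blast
    then show ?thesis by (meson finite.intros finite_subset)
  qed
  then have "finite (\<Union>e\<in>E. {x \<in> V. \<exists>a\<in>\<Lambda>. x = a + e})" using assms(4) by blast
  moreover have "(\<Lambda> + E) \<inter> V \<subseteq> (\<Union>e\<in>E. {x \<in> V. \<exists>a\<in>\<Lambda>. x = a + e})"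
    by (auto simp: set_plus_def)
  ultimately have fin: "finite ((\<Lambda> + E) \<inter> V - {0})"
    by (meson finite_Diff finite_subset)
  show ?thesis
  proof (rule that[of "V - ((\<Lambda> + E) \<inter> V - {0})"])
    show "open (V - ((\<Lambda> + E) \<inter> V - {0}))"
      using V(1) fin by (intro open_Diff finite_imp_closed)
  qed (use V(2) in auto)
qed

text \<open>Applying \<open>\<Lambda> + \<Lambda> \<subseteq> \<Lambda> + F\<close> twice puts the
  triple product into \<open>\<Lambda> + (F + F)\<close>, a finite union of right translates of a
  uniformly discrete set.\<close>

lemma approximate_lattice_triple_isolated:
  fixes \<Lambda> :: "'g::{topological_group_add, t2_space} set"
  assumes "uniform_approximate_lattice \<Lambda>"
  obtains W where "open W" "0 \<in> W" "(\<Lambda> + \<Lambda> + \<Lambda>) \<inter> W \<subseteq> {0}"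
proof -
  obtain F where F: "finite F" "\<Lambda> + \<Lambda> \<subseteq> \<Lambda> + F"
    using assms unfolding uniform_approximate_lattice_def by (elim conjE exE) (rule that)
  obtain U where U: "open U" "0 \<in> U" "{a - b | a b. a \<in> \<Lambda> \<and> b \<in> \<Lambda>} \<inter> U = {0}"
    using assms unfolding uniform_approximate_lattice_def by (elim conjE exE) (rule that)
  have "\<Lambda> + \<Lambda> + \<Lambda> = \<Lambda> + (\<Lambda> + \<Lambda>)" by (simp add: add.assoc)
  also have "\<dots> \<subseteq> \<Lambda> + (\<Lambda> + F)" by (rule set_plus_mono2[OF order_refl F(2)])
  also have "\<dots> = \<Lambda> + \<Lambda> + F" by (simp add: add.assoc)
  also have "\<dots> \<subseteq> \<Lambda> + F + F" by (rule set_plus_mono2[OF F(2) order_refl])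
  finally have sub: "\<Lambda> + \<Lambda> + \<Lambda> \<subseteq> \<Lambda> + (F + F)" by (simp add: add.assoc)
  obtain W where "open W" "0 \<in> W" "(\<Lambda> + (F + F)) \<inter> W \<subseteq> {0}"
    using uniformly_discrete_translates_isolated[OF U finite_set_plus[OF F(1) F(1)]] by blast
  with sub that show ?thesis by blast
qed

section \<open>Spreading out lattice points in a non-compact group\<close>

text \<open>Otherwise the group would be the product of two compact sets, hence compact.\<close>

lemma approximate_lattice_not_subset_compact:
  fixes \<Lambda> :: "'g::topological_group_add set"
  assumes "uniform_approximate_lattice \<Lambda>" "\<not> compact (UNIV :: 'g set)" "compact C"
  obtains b where "b \<in> \<Lambda>" "b \<notin> C"
proof -
  obtain K where K: "compact K" "K + \<Lambda> = UNIV"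
    using assms(1) unfolding uniform_approximate_lattice_def by (elim conjE exE) (rule that)
  have "\<not> \<Lambda> \<subseteq> C"
  proof
    assume "\<Lambda> \<subseteq> C"
    then have "K + C = UNIV" using K(2) set_plus_mono2[of K K \<Lambda> C] by auto
    with compact_plus_group[OF K(1) assms(3)] assms(2) show False by simp
  qed
  with that show ?thesis by blast
qed

text \<open>The points are chosen greedily, each outside a compact set determined by the earlier
  ones.\<close>

lemma approximate_lattice_finite_spread:
  fixes \<Lambda> :: "'g::topological_group_add set"
  assumes "uniform_approximate_lattice \<Lambda>" "\<not> compact (UNIV :: 'g set)" "compact K"
  shows "\<exists>T \<subseteq> \<Lambda>. finite T \<and> card T = n \<and> (\<forall>a\<in>T. \<forall>b\<in>T. a \<noteq> b \<longrightarrow> - a + b \<notin> K)"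
proof (induction n)
  case (Suc n)
  then obtain T where T: "T \<subseteq> \<Lambda>" "finite T" "card T = n"
      "\<And>a b. a \<in> T \<Longrightarrow> b \<in> T \<Longrightarrow> a \<noteq> b \<Longrightarrow> - a + b \<notin> K" by blast
  \<comment> \<open>Avoiding the three pieces gives, for every \<open>a\<close> in \<open>T\<close>,
    that \<open>b \<noteq> a\<close>, \<open>- a + b \<notin> K\<close> and
    \<open>- b + a \<notin> K\<close>; the last two are both required because \<open>K\<close> need
    not be symmetric.\<close>
  let ?C = "T \<union> (T + K) \<union> (T + uminus ` K)"
  have "compact ?C"
    using T(2) assms(3)
    by (intro compact_Un compact_plus_group compact_continuous_image continuous_on_uminus_group)
       (auto intro: finite_imp_compact)
  then obtain b where b: "b \<in> \<Lambda>" "b \<notin> ?C"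
    using approximate_lattice_not_subset_compact[OF assms(1,2)] by blast
  have "- a + b \<notin> K" "- b + a \<notin> K" if "a \<in> T" for a
  proof -
    show "- a + b \<notin> K"
    proof
      assume "- a + b \<in> K"
      with that have "a + (- a + b) \<in> T + K" by (rule set_plus_intro)
      with b show False by (simp add: add.assoc[symmetric])
    qed
    show "- b + a \<notin> K"
    proof
      assume "- b + a \<in> K"
      then have "- (- b + a) \<in> uminus ` K" by blast
      with that have "a + - (- b + a) \<in> T + uminus ` K" by (rule set_plus_intro)
      with b show False by (simp only: minus_add minus_minus add_minus_cancel) simp
    qed
  qed
  then show ?case
    using T b by (intro exI[of _ "insert b T"]) auto
qed auto

section \<open>The transverse measure\<close>

text \<open>The nonnegative integral is a supremum over simple functions below the integrand,
  measurable or not, so the integral of \<open>indicator S\<close> is the inner measure of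
  \<open>S\<close>. It is attained by the union of the supports of a maximising sequence, each
  member of which is at most \<open>1\<close> and vanishes off \<open>S\<close>.\<close>

lemma inner_measure_attained:
  assumes "S \<subseteq> space M"
  obtains B where "B \<in> sets M" "B \<subseteq> S" "emeasure M B = (\<integral>\<^sup>+x. indicator S x \<partial>M)"
proof -
  let ?G = "{g. simple_function M g \<and> g \<le> (indicator S :: _ \<Rightarrow> ennreal)}"
  have "?G \<noteq> {}"
    by (auto simp: le_fun_def intro!: exI[of _ "\<lambda>_. 0"])
  from ennreal_SUP_countable_SUP[OF this, of "integral\<^sup>S M"]
  obtain f :: "nat \<Rightarrow> ennreal" where f: "range f \<subseteq> integral\<^sup>S M ` ?G"
      "(\<integral>\<^sup>+x. indicator S x \<partial>M) = (SUP n. f n)"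
    unfolding nn_integral_def by auto
  have "\<exists>h. h \<in> ?G \<and> f n = integral\<^sup>S M h" for n
    using f(1) by auto
  then obtain s where s: "\<And>n. simple_function M (s n)" "\<And>n. s n \<le> indicator S"
      "\<And>n. f n = integral\<^sup>S M (s n)"
    by (simp only: mem_Collect_eq) metis
  define B where "B = (\<Union>n. {x \<in> space M. s n x \<noteq> 0})"
  have B: "B \<in> sets M"
    unfolding B_def by (intro sets.countable_UN'' borel_measurable_simple_function s sets.sets_Collect_neg
        borel_measurable_eq) (auto intro: borel_measurable_simple_function s)
  have BS: "B \<subseteq> S"
  proof
    fix x assume "x \<in> B"
    then obtain n where "s n x \<noteq> 0" unfolding B_def by auto
    moreover have "s n x \<le> indicator S x" using s(2)[of n] by (simp add: le_fun_def)
    ultimately show "x \<in> S" by (cases "x \<in> S") auto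
  qed
  have "f n \<le> emeasure M B" for n
  proof -
    have "f n = (\<integral>\<^sup>+x. s n x \<partial>M)"
      by (simp add: s(3) nn_integral_eq_simple_integral[OF s(1)])
    also have "\<dots> \<le> (\<integral>\<^sup>+x. indicator B x \<partial>M)"
    proof (rule nn_integral_mono)
      fix x assume "x \<in> space M"
      moreover have "s n x \<le> indicator S x" using s(2)[of n] by (simp add: le_fun_def)
      then have "s n x \<le> 1" by (rule order_trans) (simp add: indicator_def)
      ultimately show "s n x \<le> indicator B x"
        by (cases "x \<in> B") (auto simp: B_def)
    qed
    also have "\<dots> = emeasure M B" using B by simp
    finally show ?thesis .
  qed
  then have "(\<integral>\<^sup>+x. indicator S x \<partial>M) \<le> emeasure M B"
    unfolding f(2) by (intro SUP_least)
  moreover have "emeasure M B \<le> (\<integral>\<^sup>+x. indicator S x \<partial>M)"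
    unfolding nn_integral_indicator[OF B, symmetric]
    using BS by (intro nn_integral_mono) (auto simp: indicator_def)
  ultimately show ?thesis
    using that[OF B BS] by simp
qed

section \<open>Thickenings of subsets of the cross section\<close>

definition thickening :: "('g \<Rightarrow> 'x \<Rightarrow> 'x) \<Rightarrow> 'g set \<Rightarrow> 'x set \<Rightarrow> 'x set"
  where "thickening act W D = (\<lambda>(w, z). act w z) ` (W \<times> D)"

text \<open>The transverse formula is tested on the indicator of \<open>W \<times> D\<close>. A
  nonzero term at \<open>g\<close> writes \<open>x\<close> as \<open>act (- g) (act g x)\<close>
  with \<open>- g \<in> W\<close> and \<open>act g x \<in> D\<close>. By injectivity there is at
  most one such \<open>g\<close>, so the sum over hitting times is the indicator of the thickening,
  and the integral over \<open>\<mu>\<close> is its inner measure.\<close>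

lemma thickening_lower_integral:
  fixes act :: "'g::topological_group_add \<Rightarrow> 'x::topological_space \<Rightarrow> 'x"
  assumes act: "jointly_continuous_action act"
    and tm: "transverse_measure m act Z \<mu> \<nu>"
    and m: "sets m = sets borel" and Z: "Z \<in> sets borel"
    and W: "W \<in> sets borel" and inj: "inj_on (\<lambda>(w, z). act w z) (W \<times> Z)"
    and D: "D \<in> sets borel" "D \<subseteq> Z"
  shows "(\<integral>\<^sup>+x. indicator (thickening act W D) x \<partial>\<mu>) = emeasure m W * emeasure \<nu> D"
proof -
  have a0: "act 0 x = x" and aadd: "act (g + h) x = act g (act h x)" for g h x
    using act unfolding jointly_continuous_action_def by auto
  have \<nu>: "sets \<nu> = sets (restrict_space borel Z)"
    using tm unfolding transverse_measure_def by auto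
  have D\<nu>: "D \<in> sets \<nu>"
    using D Z unfolding \<nu> by (auto simp: sets_restrict_space)
  let ?f = "indicator (W \<times> D) :: 'g \<times> 'x \<Rightarrow> real"
  have "W \<times> D = fst -` W \<inter> snd -` D" by auto
  moreover have "fst -` W \<in> sets (borel :: ('g \<times> 'x) measure)"
    using measurable_sets[OF borel_measurable_continuous_onI[OF continuous_on_fst[OF continuous_on_id]] W]
    by simp
  moreover have "snd -` D \<in> sets (borel :: ('g \<times> 'x) measure)"
    using measurable_sets[OF borel_measurable_continuous_onI[OF continuous_on_snd[OF continuous_on_id]] D(1)]
    by simp
  ultimately have WD: "W \<times> D \<in> sets (borel :: ('g \<times> 'x) measure)"
    by simp
  have meas: "?f \<in> borel_measurable (restrict_space borel (UNIV \<times> Z))"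
    by (intro measurable_restrict_space1 borel_measurable_indicator WD)
  have "(\<integral>\<^sup>+ x. (\<Sum>\<^sub>\<infinity> g \<in> hitting_times act Z x. ennreal (?f (- g, act g x))) \<partial>\<mu>)
         = (\<integral>\<^sup>+ g. (\<integral>\<^sup>+ z. ennreal (?f (g, z)) \<partial>\<nu>) \<partial>m)"
    using tm meas unfolding transverse_measure_def
    by (elim conjE allE[of _ ?f]) (auto simp: indicator_def intro!: exI[of _ 1])
  also have "\<dots> = (\<integral>\<^sup>+ g. emeasure \<nu> D * indicator W g \<partial>m)"
  proof (rule nn_integral_cong)
    fix g
    have "(\<integral>\<^sup>+ z. ennreal (?f (g, z)) \<partial>\<nu>) = (\<integral>\<^sup>+ z. indicator W g * indicator D z \<partial>\<nu>)"
      by (intro nn_integral_cong) (auto simp: indicator_def)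
    also have "\<dots> = emeasure \<nu> D * indicator W g"
      using D\<nu> by (simp add: nn_integral_cmult mult.commute)
    finally show "(\<integral>\<^sup>+ z. ennreal (?f (g, z)) \<partial>\<nu>) = emeasure \<nu> D * indicator W g" .
  qed
  also have "\<dots> = emeasure m W * emeasure \<nu> D"
    using W m by (subst nn_integral_cmult) (auto simp: mult.commute)
  also have "(\<integral>\<^sup>+ x. (\<Sum>\<^sub>\<infinity> g \<in> hitting_times act Z x. ennreal (?f (- g, act g x))) \<partial>\<mu>)
      = (\<integral>\<^sup>+x. indicator (thickening act W D) x \<partial>\<mu>)"
  proof (rule nn_integral_cong)
    fix x
    show "(\<Sum>\<^sub>\<infinity> g \<in> hitting_times act Z x. ennreal (?f (- g, act g x)))
      = indicator (thickening act W D) x"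
    proof (cases "x \<in> thickening act W D")
      case True
      then obtain w z where wz: "w \<in> W" "z \<in> D" "x = act w z"
        unfolding thickening_def by auto
      have z: "act (- w) x = z" by (simp add: wz aadd[symmetric] a0)
      have zero: "?f (- g, act g x) = 0" if "- w \<noteq> g" for g
      proof (rule ccontr)
        assume "?f (- g, act g x) \<noteq> 0"
        then have g: "- g \<in> W" "act g x \<in> D" by (auto simp: indicator_def split: if_splits)
        have "act (- g) (act g x) = act w z" by (simp add: wz aadd[symmetric] a0)
        then have "(- g, act g x) = (w, z)"
          using inj_onD[OF inj, of "(- g, act g x)" "(w, z)"] g wz D(2) by auto
        with that show False by auto
      qed
      have "(\<Sum>\<^sub>\<infinity> g \<in> hitting_times act Z x. ennreal (?f (- g, act g x)))
          = (\<Sum>\<^sub>\<infinity> g \<in> {- w}. ennreal (?f (- g, act g x)))"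
        using z wz(1,2) D(2) by (intro infsum_cong_neutral) (auto simp: hitting_times_def zero)
      also have "\<dots> = 1" using wz z by simp
      finally show ?thesis using True by simp
    next
      case False
      have "?f (- g, act g x) = 0" for g
      proof (rule ccontr)
        assume "?f (- g, act g x) \<noteq> 0"
        then have g: "- g \<in> W" "act g x \<in> D" by (auto simp: indicator_def split: if_splits)
        have "x = act (- g) (act g x)" by (simp add: aadd[symmetric] a0)
        with g have "x \<in> thickening act W D" unfolding thickening_def by force
        with False show False ..
      qed
      then show ?thesis using False by simp
    qed
  qed
  finally show ?thesis .
qed

text \<open>
  Thickenings are injective continuous images of Borel sets, hence Borel by the Lusin--Souslin
  theorem. The proof does not need this: the inner measures of the thickenings of the sets
  \<open>Z \<inter> U\<close> and \<open>Z - U\<close>, with \<open>U\<close> in a countable basis, add up to that of the thickening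
  of \<open>Z\<close>, so there is a Borel set \<open>B\<close> of full inner measure on which the projection to \<open>Z\<close>
  is Borel.
\<close>

lemma thickening_measurable_projection:
  fixes act :: "'g::topological_group_add \<Rightarrow> 'x::second_countable_topology \<Rightarrow> 'x"
  assumes act: "jointly_continuous_action act"
    and tm: "transverse_measure m act Z \<mu> \<nu>"
    and m: "sets m = sets borel" and Z: "Z \<in> sets borel" "Z \<noteq> {}"
    and \<mu>: "prob_space \<mu>" "sets \<mu> = sets borel"
    and W: "W \<in> sets borel" and inj: "inj_on (\<lambda>(w, z). act w z) (W \<times> Z)"
  obtains B p where "B \<in> sets borel" "p \<in> measurable \<mu> \<nu>"
    "\<And>x. x \<in> B \<Longrightarrow> \<exists>w\<in>W. x = act w (p x)"
    "\<And>D. D \<in> sets \<nu> \<Longrightarrow> emeasure \<mu> (B \<inter> p -` D) = emeasure m W * emeasure \<nu> D"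
proof -
  interpret \<mu>: prob_space \<mu> by fact
  have sp\<mu>: "space \<mu> = UNIV" using sets_eq_imp_space_eq[OF \<mu>(2)] by simp
  have \<nu>: "sets \<nu> = sets (restrict_space borel Z)"
    using tm unfolding transverse_measure_def by auto
  have sp\<nu>: "space \<nu> = Z" using sets_eq_imp_space_eq[OF \<nu>] by (simp add: space_restrict_space)
  have \<nu>sub: "D \<in> sets \<nu> \<longleftrightarrow> D \<in> sets borel \<and> D \<subseteq> Z" for D
    using Z unfolding \<nu> by (subst sets_restrict_space_iff) auto
  let ?c = "\<lambda>D. emeasure m W * emeasure \<nu> D"
  let ?T = "thickening act W"
  have low: "(\<integral>\<^sup>+x. indicator (?T D) x \<partial>\<mu>) = ?c D" if "D \<in> sets \<nu>" for D
    using thickening_lower_integral[OF act tm m Z(1) W inj] that \<nu>sub by blast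
  \<comment> \<open>\<open>b D\<close> will be a measurable kernel of the thickening of
    \<open>D\<close> that carries its whole inner measure; \<open>upper\<close> states that no
    measurable subset of the thickening has more.\<close>
  have "\<exists>B. B \<in> sets \<mu> \<and> B \<subseteq> ?T D \<and> emeasure \<mu> B = ?c D" if "D \<in> sets \<nu>" for D
    by (rule inner_measure_attained[of "?T D" \<mu>]) (use low[OF that] sp\<mu> in auto)
  then obtain b where b: "\<And>D. D \<in> sets \<nu> \<Longrightarrow> b D \<in> sets \<mu>" "\<And>D. D \<in> sets \<nu> \<Longrightarrow> b D \<subseteq> ?T D"
      "\<And>D. D \<in> sets \<nu> \<Longrightarrow> emeasure \<mu> (b D) = ?c D"
    by metis
  have upper: "emeasure \<mu> B \<le> ?c D" if "B \<in> sets \<mu>" "B \<subseteq> ?T D" "D \<in> sets \<nu>" for B D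
    unfolding low[OF that(3), symmetric] nn_integral_indicator[OF that(1), symmetric]
    using that(2) by (intro nn_integral_mono) (auto simp: indicator_def)
  have uniq: "w = w' \<and> z = z'" if "w \<in> W" "w' \<in> W" "z \<in> Z" "z' \<in> Z" "act w z = act w' z'" for w w' z z'
    using inj_onD[OF inj, of "(w, z)" "(w', z')"] that by auto
  have Tdisj: "?T D \<inter> ?T D' = {}" if "D \<subseteq> Z" "D' \<subseteq> Z" "D \<inter> D' = {}" for D D'
  proof (rule equals0I)
    fix x assume "x \<in> ?T D \<inter> ?T D'"
    then obtain w z w' z' where "w \<in> W" "w' \<in> W" "z \<in> D" "z' \<in> D'" "x = act w z" "x = act w' z'"
      unfolding thickening_def by auto
    with uniq[of w w' z z'] that show False by auto
  qed
  have Tmono: "?T D \<subseteq> ?T D'" if "D \<subseteq> D'" for D D'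
    using that unfolding thickening_def by auto
  obtain \<B> :: "'x set set" where \<B>: "countable \<B>" "topological_basis \<B>"
    using ex_countable_basis by auto
  have U\<nu>: "Z \<inter> U \<in> sets \<nu>" "Z - U \<in> sets \<nu>" if "U \<in> \<B>" for U
    using topological_basis_open[OF \<B>(2) that] Z(1) by (auto simp: \<nu>sub)
  have Z\<nu>: "Z \<in> sets \<nu>" using Z by (simp add: \<nu>sub)
  \<comment> \<open>Finiteness, needed to cancel in \<open>ennreal\<close>, comes from
    \<open>?c D\<close> being the \<open>\<mu>\<close>-measure of \<open>b D\<close>.\<close>
  have cfin: "?c D < \<infinity>" if "D \<in> sets \<nu>" for D
    using b(3)[OF that] \<mu>.emeasure_finite[of "b D"] by (simp add: less_top)
  \<comment> \<open>On \<open>E U\<close> a measurable kernel decides whether the base point in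
    \<open>Z\<close> lies in \<open>U\<close>. On \<open>B\<close> this is decided for all basic
    open sets at once.\<close>
  define E where "E U = b (Z \<inter> U) \<union> b (Z - U)" for U
  define B where "B = b Z \<inter> (\<Inter>U\<in>\<B>. E U)"
  have E: "E U \<in> sets \<mu>" if "U \<in> \<B>" for U
    unfolding E_def using b(1) U\<nu>[OF that] by auto
  have B_eq: "B = b Z - (\<Union>U\<in>\<B>. b Z - E U)"
    unfolding B_def by auto
  have split: "?c D + ?c (Z - D) = ?c Z" if "D \<in> sets \<nu>" for D
  proof -
    have "emeasure \<nu> D + emeasure \<nu> (Z - D) = emeasure \<nu> Z"
      using that Z\<nu> \<nu>sub[of D] by (subst plus_emeasure) (auto intro!: arg_cong[of _ _ "emeasure \<nu>"])
    then show ?thesis by (simp add: distrib_left[symmetric])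
  qed
  \<comment> \<open>The two kernels in \<open>E U\<close> are disjoint and together already have
    measure \<open>?c Z\<close>, the largest possible inside the thickening of \<open>Z\<close>.
    What \<open>b Z\<close> could add to them is therefore null.\<close>
  have "b Z - E U \<in> null_sets \<mu>" if U: "U \<in> \<B>" for U
  proof -
    have UZ: "Z - (Z \<inter> U) = Z - U" by auto
    have sub: "E U \<subseteq> ?T Z"
      unfolding E_def using b(2)[OF U\<nu>(1)[OF U]] b(2)[OF U\<nu>(2)[OF U]] Tmono[of "Z \<inter> U" Z] Tmono[of "Z - U" Z]
      by blast
    have "b (Z \<inter> U) \<inter> b (Z - U) = {}"
      using b(2)[OF U\<nu>(1)[OF U]] b(2)[OF U\<nu>(2)[OF U]] Tdisj[of "Z \<inter> U" "Z - U"] by blast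
    then have EU: "emeasure \<mu> (E U) = ?c Z"
      unfolding E_def using b(1,3) U\<nu>[OF U] split[OF U\<nu>(1)[OF U]]
      by (subst plus_emeasure[symmetric]) (auto simp: UZ)
    have "?c Z + emeasure \<mu> (b Z - E U) = emeasure \<mu> (E U \<union> (b Z - E U))"
      unfolding EU[symmetric] using E[OF U] b(1)[OF Z\<nu>] by (intro plus_emeasure) auto
    also have "\<dots> \<le> ?c Z"
      using E[OF U] b(1,2)[OF Z\<nu>] sub Z\<nu> by (intro upper) auto
    finally have "?c Z + emeasure \<mu> (b Z - E U) \<le> ?c Z + 0" by simp
    then have "emeasure \<mu> (b Z - E U) = 0"
      using cfin[OF Z\<nu>] by (subst (asm) ennreal_add_left_cancel_le) auto
    then show ?thesis using E[OF U] b(1)[OF Z\<nu>] by (intro null_setsI) auto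
  qed
  then have null: "(\<Union>U\<in>\<B>. b Z - E U) \<in> null_sets \<mu>"
    using \<B>(1) by (intro null_sets_UN')
  have B\<mu>: "B \<in> sets \<mu>"
    unfolding B_eq using b(1)[OF Z\<nu>] null by auto
  have B_meas: "emeasure \<mu> B = ?c Z"
    unfolding B_eq emeasure_Diff_null_set[OF null b(1)[OF Z\<nu>]] by (rule b(3)[OF Z\<nu>])
  have BT: "B \<subseteq> ?T Z" unfolding B_def using b(2)[OF Z\<nu>] by auto
  obtain z0 where z0: "z0 \<in> Z" using Z(2) by auto
  \<comment> \<open>The default value \<open>z0\<close> outside \<open>B\<close> makes
    \<open>p\<close> a map into \<open>Z\<close> on the whole space.\<close>
  have "\<exists>z. if x \<in> B then z \<in> Z \<and> (\<exists>w\<in>W. x = act w z) else z = z0" for x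
    using BT unfolding thickening_def by (cases "x \<in> B") force+
  then obtain p where p: "\<And>x. if x \<in> B then p x \<in> Z \<and> (\<exists>w\<in>W. x = act w (p x)) else p x = z0"
    by metis
  have pZ: "p x \<in> Z" for x using p[of x] z0 by (auto split: if_splits)
  have pB: "\<exists>w\<in>W. x = act w (p x)" if "x \<in> B" for x using p[of x] that by auto
  have p_iff: "x \<in> ?T D \<longleftrightarrow> p x \<in> D" if xD: "x \<in> B" "D \<subseteq> Z" for x D
  proof
    assume "x \<in> ?T D"
    then obtain w z where wz: "w \<in> W" "z \<in> D" "x = act w z" unfolding thickening_def by auto
    obtain w' where w': "w' \<in> W" "x = act w' (p x)" using pB[OF xD(1)] by blast
    have "z = p x"
      using uniq[OF wz(1) w'(1) subsetD[OF xD(2) wz(2)] pZ trans[OF wz(3)[symmetric] w'(2)]] by simp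
    with wz(2) show "p x \<in> D" by simp
  next
    assume "p x \<in> D"
    with pB[OF xD(1)] show "x \<in> ?T D" unfolding thickening_def by force
  qed
  \<comment> \<open>A point of \<open>B\<close> lies in one of the kernels for
    \<open>Z \<inter> U\<close> and \<open>Z - U\<close>, and its base point \<open>p x\<close>
    tells which. Hence the preimage of a basic open set is measurable.\<close>
  have pU: "B \<inter> p -` U = B \<inter> b (Z \<inter> U)" if U: "U \<in> \<B>" for U
  proof -
    have "x \<in> b (Z \<inter> U) \<longleftrightarrow> p x \<in> U" if x: "x \<in> B" for x
    proof
      assume "x \<in> b (Z \<inter> U)"
      then show "p x \<in> U" using b(2)[OF U\<nu>(1)[OF U]] p_iff[OF x, of "Z \<inter> U"] by auto
    next
      assume "p x \<in> U"
      then have "x \<notin> b (Z - U)" using b(2)[OF U\<nu>(2)[OF U]] p_iff[OF x, of "Z - U"] by auto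
      moreover have "x \<in> E U" using x U unfolding B_def by auto
      ultimately show "x \<in> b (Z \<inter> U)" unfolding E_def by auto
    qed
    then show ?thesis by auto
  qed
  have p_borel: "p \<in> measurable \<mu> borel"
    unfolding borel_eq_countable_basis[OF \<B>]
  proof (rule measurable_measure_of)
    fix U assume U: "U \<in> \<B>"
    have "p -` U \<inter> space \<mu> = (B \<inter> p -` U) \<union> (if z0 \<in> U then space \<mu> - B else {})"
      using p sets.sets_into_space[OF B\<mu>] by (auto simp: sp\<mu>) (metis)+
    also have "\<dots> \<in> sets \<mu>"
      unfolding pU[OF U] using B\<mu> b(1)[OF U\<nu>(1)[OF U]] by auto
    finally show "p -` U \<inter> space \<mu> \<in> sets \<mu>" .
  qed auto
  have p_meas: "p \<in> measurable \<mu> \<nu>"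
    unfolding measurable_cong_sets[OF refl \<nu>]
    using p_borel pZ by (intro measurable_restrict_space2) auto
  have pre: "B \<inter> p -` D \<in> sets \<mu>" if "D \<in> sets \<nu>" for D
    using measurable_sets[OF p_meas that] B\<mu> by (auto simp: sp\<mu>)
  have pre_le: "emeasure \<mu> (B \<inter> p -` D) \<le> ?c D" if D: "D \<in> sets \<nu>" for D
    using D \<nu>sub[of D] p_iff[of _ D] by (intro upper pre) auto
  \<comment> \<open>The upper bounds for \<open>D\<close> and \<open>Z - D\<close> add up to the
    measure of \<open>B\<close>, so both are equalities.\<close>
  have "emeasure \<mu> (B \<inter> p -` D) = ?c D" if D: "D \<in> sets \<nu>" for D
  proof (rule antisym[OF pre_le[OF D]])
    have DZ: "D \<subseteq> Z" "Z - D \<in> sets \<nu>" using D \<nu>sub Z\<nu> by auto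
    have "?c D + ?c (Z - D) = emeasure \<mu> B"
      by (simp add: B_meas split[OF D])
    also have "\<dots> = emeasure \<mu> ((B \<inter> p -` D) \<union> (B \<inter> p -` (Z - D)))"
      using pZ by (intro arg_cong[of _ _ "emeasure \<mu>"]) auto
    also have "\<dots> = emeasure \<mu> (B \<inter> p -` D) + emeasure \<mu> (B \<inter> p -` (Z - D))"
      using pre D DZ by (intro plus_emeasure[symmetric]) auto
    also have "\<dots> \<le> emeasure \<mu> (B \<inter> p -` D) + ?c (Z - D)"
      using pre_le[OF DZ(2)] by (intro add_left_mono)
    finally have "?c (Z - D) + ?c D \<le> ?c (Z - D) + emeasure \<mu> (B \<inter> p -` D)"
      by (simp add: add.commute)
    then show "?c D \<le> emeasure \<mu> (B \<inter> p -` D)"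
      using cfin[OF DZ(2)] by (subst (asm) ennreal_add_left_cancel_le) auto
  qed
  with that[of B p] B\<mu> \<mu>(2) p_meas pB show ?thesis by auto
qed

section \<open>Transport to finite powers\<close>

text \<open>By \<open>tr\<close>, the image under \<open>p\<close> of \<open>\<mu>\<close>
  restricted to \<open>B\<close> is \<open>r\<close> times \<open>\<nu>\<close>. The corresponding
  statement for powers holds on boxes and extends to all measurable sets by uniqueness of the
  product measure.\<close>

lemma product_transport:
  fixes \<mu> :: "'x measure" and \<nu> :: "'y measure"
  assumes "finite_measure \<mu>" "finite_measure \<nu>" "finite I"
    and p: "p \<in> measurable \<mu> \<nu>" and B: "B \<in> sets \<mu>" and r: "0 < r"
    and tr: "\<And>D. D \<in> sets \<nu> \<Longrightarrow> emeasure \<mu> (B \<inter> p -` D) = ennreal r * emeasure \<nu> D"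
    and A: "A \<in> sets (Pi\<^sub>M I (\<lambda>_. \<nu>))"
  defines "E \<equiv> {x \<in> space (Pi\<^sub>M I (\<lambda>_. \<mu>)). (\<forall>i\<in>I. x i \<in> B) \<and> (\<lambda>i\<in>I. p (x i)) \<in> A}"
  shows "E \<in> sets (Pi\<^sub>M I (\<lambda>_. \<mu>))"
    and "emeasure (Pi\<^sub>M I (\<lambda>_. \<mu>)) E = ennreal (r ^ card I) * emeasure (Pi\<^sub>M I (\<lambda>_. \<nu>)) A"
proof -
  interpret \<mu>: finite_measure \<mu> by fact
  interpret \<nu>: finite_measure \<nu> by fact
  interpret P\<mu>: product_sigma_finite "\<lambda>_. \<mu>" ..
  interpret P\<nu>: product_sigma_finite "\<lambda>_. \<nu>" ..
  let ?M = "Pi\<^sub>M I (\<lambda>_. \<mu>)" and ?N = "Pi\<^sub>M I (\<lambda>_. \<nu>)"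
  define q where "q = (\<lambda>x. \<lambda>i\<in>I. p (x i))"
  define C where "C = {x \<in> space ?M. \<forall>i\<in>I. x i \<in> B}"
  have q: "q \<in> measurable ?M ?N"
    unfolding q_def by (intro measurable_restrict measurable_compose[OF _ p] measurable_component_singleton)
  have Ceq: "C = (\<Pi>\<^sub>E i\<in>I. B)"
    using sets.sets_into_space[OF B] unfolding C_def by (auto simp: space_PiM PiE_iff extensional_def)
  have C: "C \<in> sets ?M"
    unfolding Ceq using B assms(3) by (intro sets_PiM_I_finite) auto
  \<comment> \<open>The image of the product measure restricted to the power \<open>C\<close> of
    \<open>B\<close>, rescaled so that it agrees with the power of \<open>\<nu>\<close> on
    boxes.\<close>
  define P where "P = scale_measure (ennreal (1 / r ^ card I)) (distr (density ?M (indicator C)) ?N q)"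
  have P: "emeasure P D = ennreal (1 / r ^ card I) * emeasure ?M (C \<inter> q -` D)" if "D \<in> sets ?N" for D
  proof -
    have "q -` D \<inter> space ?M \<in> sets ?M" using q that by (rule measurable_sets)
    moreover have "C \<inter> (q -` D \<inter> space ?M) = C \<inter> q -` D" unfolding C_def by auto
    ultimately show ?thesis
      unfolding P_def using q that C by (simp add: emeasure_distr emeasure_restricted)
  qed
  have "P = ?N"
  proof (rule P\<nu>.PiM_eqI)
    show "sets P = sets ?N" unfolding P_def by simp
    fix D assume D: "\<And>i. i \<in> I \<Longrightarrow> D i \<in> sets \<nu>"
    have "C \<inter> q -` Pi\<^sub>E I D = (\<Pi>\<^sub>E i\<in>I. B \<inter> p -` D i)"
      unfolding Ceq q_def by (auto simp: PiE_iff)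
    moreover have "B \<inter> p -` D i \<in> sets \<mu>" if "i \<in> I" for i
    proof -
      have "B \<inter> p -` D i = B \<inter> (p -` D i \<inter> space \<mu>)" using sets.sets_into_space[OF B] by auto
      then show ?thesis using measurable_sets[OF p D[OF that]] B by auto
    qed
    ultimately have "emeasure ?M (C \<inter> q -` Pi\<^sub>E I D) = (\<Prod>i\<in>I. emeasure \<mu> (B \<inter> p -` D i))"
      using assms(3) by (simp add: P\<mu>.emeasure_PiM)
    also have "\<dots> = (\<Prod>i\<in>I. ennreal r * emeasure \<nu> (D i))"
      by (intro prod.cong refl tr D)
    also have "\<dots> = ennreal (r ^ card I) * (\<Prod>i\<in>I. emeasure \<nu> (D i))"
      using r by (simp add: prod.distrib ennreal_power)
    finally have "emeasure P (Pi\<^sub>E I D)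
        = ennreal (1 / r ^ card I) * (ennreal (r ^ card I) * (\<Prod>i\<in>I. emeasure \<nu> (D i)))"
      using D assms(3) by (subst P) auto
    then show "emeasure P (Pi\<^sub>E I D) = (\<Prod>i\<in>I. emeasure \<nu> (D i))"
      using r by (simp add: mult.assoc[symmetric] ennreal_mult[symmetric])
  qed (rule assms(3))
  have Eeq: "E = C \<inter> q -` A" unfolding E_def C_def q_def by auto
  have "q -` A \<inter> space ?M \<in> sets ?M" using q A by (rule measurable_sets)
  moreover have "E = C \<inter> (q -` A \<inter> space ?M)" unfolding Eeq C_def by auto
  ultimately show "E \<in> sets ?M" using C by auto
  have "ennreal (r ^ card I) * emeasure ?N A = ennreal (r ^ card I) * emeasure P A"
    by (simp add: \<open>P = ?N\<close>)
  also have "\<dots> = emeasure ?M E"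
    unfolding P[OF A] Eeq using r by (simp add: mult.assoc[symmetric] ennreal_mult[symmetric])
  finally show "emeasure ?M E = ennreal (r ^ card I) * emeasure ?N A" by simp
qed

section \<open>Recurrence\<close>

text \<open>A packing argument: a set \<open>A\<close> of positive measure would produce, for the
  points of a widely spread finite subset of the return times, more disjoint sets of equal measure
  than a probability space can hold.\<close>

lemma no_returns_imp_null:
  fixes act :: "'g::{topological_group_add, t2_space, second_countable_topology}
                  \<Rightarrow> 'x::second_countable_topology \<Rightarrow> 'x"
  assumes lcsc: "lcsc_group TYPE('g)"
    and noncompact: "\<not> compact (UNIV :: 'g set)"
    and unimod: "unimodular_group TYPE('g)"
    and haar: "left_haar_measure m"
    and act: "jointly_continuous_action act"
    and cross: "cross_section act Z"
    and inv: "invariant_prob_measure act \<mu>"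
    and tm: "transverse_measure m act Z \<mu> \<nu>"
    and lattice: "uniform_approximate_lattice (return_times act Z)"
    and I: "finite I" and A: "A \<in> sets (Pi\<^sub>M I (\<lambda>_. \<nu>))"
    and K: "compact K"
    and no_return: "\<And>a b z z'. a \<in> return_times act Z \<Longrightarrow> b \<in> return_times act Z \<Longrightarrow>
      z \<in> A \<Longrightarrow> z' \<in> A \<Longrightarrow> (\<And>i. i \<in> I \<Longrightarrow> act (- a + b) (z i) = z' i) \<Longrightarrow> - a + b \<in> K"
  shows "emeasure (Pi\<^sub>M I (\<lambda>_. \<nu>)) A = 0"
proof (rule ccontr)
  assume "emeasure (Pi\<^sub>M I (\<lambda>_. \<nu>)) A \<noteq> 0"
  define \<Lambda> where "\<Lambda> = return_times act Z"
  have a0: "act 0 x = x" and aadd: "act (g + h) x = act g (act h x)" for g h x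
    using act unfolding jointly_continuous_action_def by auto
  have Z: "Z \<in> sets borel" "Z \<noteq> {}"
    using cross unfolding cross_section_def by auto
  have \<mu>: "prob_space \<mu>" "sets \<mu> = sets borel"
    using inv unfolding invariant_prob_measure_def by auto
  have \<nu>: "sets \<nu> = sets (restrict_space borel Z)" "finite_measure \<nu>"
    using tm unfolding transverse_measure_def by auto
  have m: "sets m = sets borel" and mfin: "\<And>K. compact K \<Longrightarrow> emeasure m K < \<infinity>"
    using haar unfolding left_haar_measure_def by auto
  have rinv: "emeasure m ((\<lambda>h. h + g) ` V) = emeasure m V" if "V \<in> sets borel" for g V
    using unimod haar that unfolding unimodular_group_def by blast
  interpret \<mu>: prob_space \<mu> by fact
  interpret \<nu>: finite_measure \<nu> by fact
  interpret P\<mu>: product_prob_space "\<lambda>_. \<mu>" I ..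
  interpret P\<nu>: product_sigma_finite "\<lambda>_. \<nu>" ..
  let ?M = "Pi\<^sub>M I (\<lambda>_. \<mu>)" and ?N = "Pi\<^sub>M I (\<lambda>_. \<nu>)"
  interpret N: finite_measure ?N
    by (rule finite_measureI) (simp add: space_PiM P\<nu>.emeasure_PiM I power_eq_top_ennreal)
  have neg: "- a \<in> \<Lambda>" if "a \<in> \<Lambda>" for a
    using lattice that unfolding uniform_approximate_lattice_def \<Lambda>_def by blast
  have \<Lambda>I: "g \<in> \<Lambda>" if "z \<in> Z" "act g z \<in> Z" for g z
    using that unfolding \<Lambda>_def return_times_def by auto
  obtain W0 where W0: "open W0" "0 \<in> W0" "(\<Lambda> + \<Lambda> + \<Lambda>) \<inter> W0 \<subseteq> {0}"
    using approximate_lattice_triple_isolated[OF lattice] unfolding \<Lambda>_def by blast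
  obtain V1 where V1: "open V1" "0 \<in> V1" "\<And>a b. a \<in> V1 \<Longrightarrow> b \<in> V1 \<Longrightarrow> - a + b \<in> W0"
    using open_zero_diff_subset[OF W0(1,2)] by metis
  have "\<exists>U L. open U \<and> compact L \<and> 0 \<in> U \<and> U \<subseteq> (L :: 'g set)"
    using lcsc unfolding lcsc_group_def locally_compact_space_def by auto
  then obtain O1 L where O1: "open O1" "compact L" "0 \<in> O1" "O1 \<subseteq> (L :: 'g set)"
    by blast
  \<comment> \<open>\<open>V1\<close> keeps \<open>- v' + v\<close> inside \<open>W0\<close>, and
    \<open>O1\<close> lies in a compact set, which bounds the Haar measure of
    \<open>V\<close>.\<close>
  define V where "V = V1 \<inter> O1"
  have V: "open V" "V \<noteq> {}" using V1 O1 unfolding V_def by auto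
  have triple: "- v' + v = 0"
    if "v \<in> V" "v' \<in> V" "a \<in> \<Lambda>" "b \<in> \<Lambda>" "c \<in> \<Lambda>" "- v' + v = a + b + c" for v v' a b c
  proof -
    have "- v' + v \<in> W0" using V1(3) that(1,2) unfolding V_def by blast
    moreover have "- v' + v \<in> \<Lambda> + \<Lambda> + \<Lambda>"
      unfolding that(6) by (intro set_plus_intro that)
    ultimately show ?thesis using W0(3) by blast
  qed
  \<comment> \<open>The element \<open>g = - l' + (- v' + v) + l\<close> sends \<open>z\<close> to
    \<open>z'\<close>, both in \<open>Z\<close>, so it is a return time. Then
    \<open>- v' + v = l' + g - l\<close> is in the triple product and in \<open>W0\<close>, hence
    zero. For \<open>l = l'\<close> this is injectivity of the parametrisation; for different
    \<open>l\<close>, \<open>l'\<close> it controls overlaps.\<close>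
  have same: "v = v' \<and> act (- l' + l) z = z'"
    if v: "v \<in> V" "v' \<in> V" and l: "l \<in> \<Lambda>" "l' \<in> \<Lambda>" and z: "z \<in> Z" "z' \<in> Z"
      and eq: "act (v + l) z = act (v' + l') z'" for v v' l l' z z'
  proof -
    define g where "g = - l' + (- v' + v) + l"
    have "act (- (v' + l')) (act (v + l) z) = z'"
      unfolding eq by (simp only: aadd[symmetric] left_minus a0)
    moreover have "- (v' + l') + (v + l) = g"
      unfolding g_def by (simp only: minus_add add.assoc)
    ultimately have gz: "act g z = z'" by (simp only: aadd[symmetric])
    then have g: "g \<in> \<Lambda>" using \<Lambda>I z by auto
    have "- v' + v = l' + g + (- l)"
      unfolding g_def by (simp only: add.assoc add_minus_cancel right_minus add_0_right)
    then have "- v' + v = 0" using triple[OF v l(2) g neg[OF l(1)]] by simp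
    then show ?thesis using gz unfolding g_def by (simp add: neg_eq_iff_add_eq_0[symmetric] del: add_uminus_conv_diff)
  qed
  have "emeasure m V > 0" using haar_open_pos[OF haar V] .
  moreover have "emeasure m V < \<infinity>"
  proof -
    have "emeasure m V \<le> emeasure m L"
      using O1 m unfolding V_def by (intro emeasure_mono) (auto intro: borel_compact)
    also have "\<dots> < \<infinity>" using mfin[OF O1(2)] .
    finally show ?thesis .
  qed
  ultimately obtain r where r: "0 < r" "emeasure m V = ennreal r"
    by (cases "emeasure m V") (auto simp: ennreal_less_zero_iff)
  define t where "t = r ^ card I * measure ?N A"
  have "measure ?N A > 0"
    using \<open>emeasure ?N A \<noteq> 0\<close> by (simp add: N.emeasure_eq_measure zero_less_measure_iff)
  then have t: "t > 0" unfolding t_def using r by simp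
  \<comment> \<open>\<open>E\<close> is a measurable part of the thickening of \<open>A\<close>
    translated by \<open>l\<close>: the same \<open>l\<close> acts on all coordinates, while
    \<open>v\<close> may vary with \<open>i\<close>.\<close>
  have "\<exists>E. E \<in> sets ?M \<and> measure ?M E = t \<and>
      (\<forall>x\<in>E. \<exists>z\<in>A. \<forall>i\<in>I. \<exists>v\<in>V. x i = act (v + l) (z i))" if l: "l \<in> \<Lambda>" for l
  proof -
    let ?W = "(\<lambda>h. h + l) ` V"
    have W: "?W \<in> sets borel" using open_right_translate[OF V(1)] by auto
    have inj: "inj_on (\<lambda>(w, z). act w z) (?W \<times> Z)"
    proof (rule inj_onI, clarify)
      fix v z v' z'
      assume "v \<in> V" "v' \<in> V" "z \<in> Z" "z' \<in> Z" "act (v + l) z = act (v' + l) z'"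
      from same[OF this(1,2) l l this(3-5)] show "v + l = v' + l \<and> z = z'"
        by (simp add: a0)
    qed
    obtain B p where Bp: "B \<in> sets borel" "p \<in> measurable \<mu> \<nu>"
        "\<And>x. x \<in> B \<Longrightarrow> \<exists>w\<in>?W. x = act w (p x)"
        "\<And>D. D \<in> sets \<nu> \<Longrightarrow> emeasure \<mu> (B \<inter> p -` D) = emeasure m ?W * emeasure \<nu> D"
      using thickening_measurable_projection[OF act tm m Z \<mu> W inj] by blast
    \<comment> \<open>Right invariance of Haar measure makes the factor \<open>r\<close> independent
      of \<open>l\<close>.\<close>
    have tr: "emeasure \<mu> (B \<inter> p -` D) = ennreal r * emeasure \<nu> D" if "D \<in> sets \<nu>" for D
      using Bp(4)[OF that] rinv[of V l] V(1) r by simp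
    define E where "E = {x \<in> space ?M. (\<forall>i\<in>I. x i \<in> B) \<and> (\<lambda>i\<in>I. p (x i)) \<in> A}"
    have B: "B \<in> sets \<mu>" using Bp(1) \<mu>(2) by simp
    have E: "E \<in> sets ?M" "emeasure ?M E = ennreal (r ^ card I) * emeasure ?N A"
      unfolding E_def
      by (rule product_transport[OF \<mu>.finite_measure_axioms \<nu>(2) I Bp(2) B r(1) tr A]; assumption)+
    have "emeasure ?M E = ennreal t"
      using r unfolding E(2) t_def N.emeasure_eq_measure by (simp add: ennreal_mult)
    then have "measure ?M E = t" using t by (simp add: measure_def)
    moreover have "\<exists>z\<in>A. \<forall>i\<in>I. \<exists>v\<in>V. x i = act (v + l) (z i)" if "x \<in> E" for x
      using that Bp(3) unfolding E_def by (intro bexI[of _ "\<lambda>i\<in>I. p (x i)"]) auto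
    ultimately show ?thesis using E(1) by blast
  qed
  then obtain E where E: "\<And>l. l \<in> \<Lambda> \<Longrightarrow> E l \<in> sets ?M" "\<And>l. l \<in> \<Lambda> \<Longrightarrow> measure ?M (E l) = t"
      "\<And>l x. l \<in> \<Lambda> \<Longrightarrow> x \<in> E l \<Longrightarrow> \<exists>z\<in>A. \<forall>i\<in>I. \<exists>v\<in>V. x i = act (v + l) (z i)"
    by metis
  have AZ: "z i \<in> Z" if "z \<in> A" "i \<in> I" for z i
  proof -
    have "z \<in> space ?N" using sets.sets_into_space[OF A] that(1) by auto
    with that(2) show ?thesis
      using sets_eq_imp_space_eq[OF \<nu>(1)] by (auto simp: space_PiM space_restrict_space)
  qed
  \<comment> \<open>At a common point the elements \<open>v\<close> and \<open>v'\<close> agree in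
    every coordinate, so the single element \<open>- a + b\<close> carries \<open>z\<close> to
    \<open>z'\<close> in all coordinates simultaneously and \<open>no_return\<close>
    applies.\<close>
  have disj: "E a \<inter> E b = {}" if ab: "a \<in> \<Lambda>" "b \<in> \<Lambda>" "- a + b \<notin> K" for a b
  proof (rule equals0I)
    fix x assume x: "x \<in> E a \<inter> E b"
    obtain z' where z': "z' \<in> A" "\<And>i. i \<in> I \<Longrightarrow> \<exists>v\<in>V. x i = act (v + a) (z' i)"
      using E(3)[of a x] ab x by auto
    obtain z where z: "z \<in> A" "\<And>i. i \<in> I \<Longrightarrow> \<exists>v\<in>V. x i = act (v + b) (z i)"
      using E(3)[of b x] ab x by auto
    have "act (- a + b) (z i) = z' i" if i: "i \<in> I" for i
    proof -
      obtain v v' where "v \<in> V" "v' \<in> V" "x i = act (v + b) (z i)" "x i = act (v' + a) (z' i)"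
        using z(2)[OF i] z'(2)[OF i] by blast
      then show ?thesis
        using same[of v v' b a "z i" "z' i"] ab AZ[OF z(1) i] AZ[OF z'(1) i] by auto
    qed
    then have "- a + b \<in> K"
      using no_return[of a b z z'] ab z z' unfolding \<Lambda>_def by blast
    with ab show False by simp
  qed
  \<comment> \<open>With \<open>n\<close> larger than \<open>1 / t\<close>, the union of
    \<open>n\<close> disjoint sets of measure \<open>t\<close> exceeds total mass
    \<open>1\<close>.\<close>
  obtain n :: nat where n: "1 < of_nat n * t"
    using reals_Archimedean3[OF t] by blast
  obtain T where T: "T \<subseteq> \<Lambda>" "finite T" "card T = n"
      "\<And>a b. a \<in> T \<Longrightarrow> b \<in> T \<Longrightarrow> a \<noteq> b \<Longrightarrow> - a + b \<notin> K"
    using approximate_lattice_finite_spread[OF lattice noncompact K, of n] unfolding \<Lambda>_def by blast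
  have "measure ?M (\<Union>l\<in>T. E l) = (\<Sum>l\<in>T. measure ?M (E l))"
  proof (rule measure_finite_Union)
    show "disjoint_family_on E T"
      unfolding disjoint_family_on_def using disj T by blast
  qed (use T E in auto)
  also have "\<dots> = of_nat n * t"
    using T E(2) by (subst sum.cong[OF refl, of T _ "\<lambda>_. t"]) auto
  finally show False
    using n P\<mu>.P.prob_le_1[of "\<Union>l\<in>T. E l"] by simp
qed

section \<open>Almost sure recurrence from countably many null sets\<close>

theorem theorem1p5:
  fixes act :: "'g::{topological_group_add, t2_space, second_countable_topology}
                  \<Rightarrow> 'x::polish_space \<Rightarrow> 'x"
    and m :: "'g measure"
    and Z :: "'x set"
    and \<mu> \<nu> :: "'x measure"
  assumes "lcsc_group TYPE('g)"
    and "\<not> compact (UNIV :: 'g set)"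
    and "unimodular_group TYPE('g)"
    and "left_haar_measure m"
    and "jointly_continuous_action act"
    and "cross_section act Z"
    and "separated act Z"
    and "invariant_prob_measure act \<mu>"
    and "transverse_measure m act Z \<mu> \<nu>"
    and "uniform_approximate_lattice (return_times act Z)"
  shows "\<forall>r. transversally_recurrent act Z \<nu> r"
proof
  fix r :: nat
  let ?I = "{1..r}" and ?\<Lambda> = "return_times act Z"
  let ?N = "Pi\<^sub>M ?I (\<lambda>_. \<nu>)"
  \<comment> \<open>The candidate return elements. This set is countable, so only countable unions
    occur in the bad sets below.\<close>
  define S where "S = (\<lambda>(a, b). - a + b) ` (?\<Lambda> \<times> ?\<Lambda>)"
  have Z: "Z \<in> sets borel" using assms(6) unfolding cross_section_def by auto
  have \<nu>: "sets \<nu> = sets (restrict_space borel Z)"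
    using assms(9) unfolding transverse_measure_def by auto
  have sp\<nu>: "space \<nu> = Z"
    using sets_eq_imp_space_eq[OF \<nu>] by (simp add: space_restrict_space)
  have \<nu>sub: "D \<in> sets \<nu> \<longleftrightarrow> D \<in> sets borel \<and> D \<subseteq> Z" for D
    using Z unfolding \<nu> by (subst sets_restrict_space_iff) auto
  obtain U where "open U" "0 \<in> U" "{a - b | a b. a \<in> ?\<Lambda> \<and> b \<in> ?\<Lambda>} \<inter> U = {0}"
    using assms(10) unfolding uniform_approximate_lattice_def by (elim conjE exE) (rule that)
  then have "countable ?\<Lambda>" by (rule uniformly_discrete_countable)
  then have S: "countable S" unfolding S_def by auto
  have actm: "act g \<in> borel_measurable borel" for g
  proof (rule borel_measurable_continuous_onI)
    have "continuous_on UNIV (\<lambda>(g, x). act g x)"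
      using assms(5) unfolding jointly_continuous_action_def by auto
    then have "continuous_on UNIV ((\<lambda>(g, x). act g x) \<circ> Pair g)"
      by (intro continuous_on_compose continuous_intros) (auto intro: continuous_on_subset)
    then show "continuous_on UNIV (act g)" by (simp add: o_def)
  qed
  obtain C :: "nat \<Rightarrow> 'g set" where C: "\<And>n. compact (C n)"
      "\<And>K. compact K \<Longrightarrow> \<exists>N. \<forall>n\<ge>N. K \<subseteq> C n"
    using lcsc_compact_exhaustion[OF assms(1)] by blast
  obtain \<B> :: "'x set set" where \<B>: "countable \<B>" "topological_basis \<B>"
    using ex_countable_basis by auto
  \<comment> \<open>The bad set for \<open>n\<close> and the box \<open>U\<close>: points of the box
    that no element of \<open>S\<close> outside \<open>C n\<close> brings back into the box and into
    \<open>Z\<close> in every coordinate.\<close>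
  define A where "A n U = {z \<in> space ?N. \<forall>i\<in>?I. z i \<in> U i} -
      (\<Union>g\<in>S - C n. {z \<in> space ?N. \<forall>i\<in>?I. act g (z i) \<in> Z \<inter> U i})" for n and U :: "nat \<Rightarrow> 'x set"
  have cyl: "{z \<in> space ?N. \<forall>i\<in>?I. f (z i) \<in> D i} \<in> sets ?N"
    if "f \<in> borel_measurable borel" "\<And>i. i \<in> ?I \<Longrightarrow> D i \<in> sets borel" for f :: "'x \<Rightarrow> 'x" and D
  proof (rule sets.sets_Collect_finite_All)
    fix i assume i: "i \<in> ?I"
    have "f -` D i \<inter> Z \<in> sets \<nu>"
      using measurable_sets[OF that(1) that(2)[OF i]] Z by (auto simp: \<nu>sub)
    from measurable_sets[OF measurable_component_singleton[OF i] this]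
    show "{z \<in> space ?N. f (z i) \<in> D i} \<in> sets ?N"
      by (rule back_subst[of "\<lambda>S. S \<in> sets ?N"]) (use i sp\<nu> in \<open>auto simp: space_PiM\<close>)
  qed simp
  have null: "A n U \<in> null_sets ?N" if U: "U \<in> (\<Pi>\<^sub>E i\<in>?I. \<B>)" for n U
  proof (rule null_setsI)
    have Ui: "U i \<in> sets borel" if "i \<in> ?I" for i
      using U that topological_basis_open[OF \<B>(2)] by (auto simp: PiE_iff)
    show AN: "A n U \<in> sets ?N"
      unfolding A_def
    proof (intro sets.Diff sets.countable_UN'')
      show "{z \<in> space ?N. \<forall>i\<in>?I. z i \<in> U i} \<in> sets ?N"
        using cyl[of "\<lambda>x. x" U] Ui by simp
      show "{z \<in> space ?N. \<forall>i\<in>?I. act g (z i) \<in> Z \<inter> U i} \<in> sets ?N" for g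
        using Z Ui by (intro cyl actm) auto
      show "countable (S - C n)" using S by auto
    qed
    show "emeasure ?N (A n U) = 0"
    proof (rule no_returns_imp_null[OF assms(1-6,8-10) _ AN C(1)[of n]])
      fix a b z z'
      assume ab: "a \<in> ?\<Lambda>" "b \<in> ?\<Lambda>" and z: "z \<in> A n U" "z' \<in> A n U"
        and eq: "\<And>i. i \<in> ?I \<Longrightarrow> act (- a + b) (z i) = z' i"
      have "- a + b \<in> S" unfolding S_def using ab by force
      moreover have "z \<in> space ?N" "\<And>i. i \<in> ?I \<Longrightarrow> act (- a + b) (z i) \<in> Z \<inter> U i"
        using z eq unfolding A_def by (auto simp: space_PiM sp\<nu>)
      ultimately show "- a + b \<in> C n"
        using z(1) unfolding A_def by blast
    qed simp
  qed
  \<comment> \<open>Extensional families indexed by a finite set are countable in number, which is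
    why boxes are taken from \<open>PiE\<close> and restricted to \<open>{1..r}\<close>
    below.\<close>
  have "countable (\<Pi>\<^sub>E i\<in>?I. \<B>)"
    by (intro countable_PiE \<B>(1)) simp
  then have "AE z in ?N. \<forall>U\<in>(\<Pi>\<^sub>E i\<in>?I. \<B>). \<forall>n. z \<notin> A n U"
    using null by (simp add: AE_ball_countable AE_all_countable AE_not_in)
  then show "transversally_recurrent act Z \<nu> r"
    unfolding transversally_recurrent_def
  proof (rule AE_mp, intro AE_I2 impI)
    fix z assume z: "z \<in> space ?N" and notA: "\<forall>U\<in>(\<Pi>\<^sub>E i\<in>?I. \<B>). \<forall>n. z \<notin> A n U"
    have "\<exists>g. g \<notin> C n \<and> (\<forall>i\<in>?I. act g (z i) \<in> Z \<and> dist (act g (z i)) (z i) < 1 / Suc n)" for n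
    proof -
      \<comment> \<open>A basic box around \<open>z\<close> of radius \<open>1 / Suc n\<close> is
        chosen; since \<open>z\<close> is not in the corresponding bad set, some element outside
        \<open>C n\<close> returns \<open>z\<close> to that box.\<close>
      have "\<exists>U\<in>\<B>. z i \<in> U \<and> U \<subseteq> ball (z i) (1 / Suc n)" for i
        by (rule topological_basisE[OF \<B>(2), of "ball (z i) (1 / Suc n)" "z i"]) auto
      then obtain U where U: "\<And>i. U i \<in> \<B>" "\<And>i. z i \<in> U i" "\<And>i. U i \<subseteq> ball (z i) (1 / Suc n)"
        by metis
      have "restrict U ?I \<in> (\<Pi>\<^sub>E i\<in>?I. \<B>)" using U(1) by simp
      with notA have "z \<notin> A n (restrict U ?I)" by blast
      moreover have "z \<in> {z \<in> space ?N. \<forall>i\<in>?I. z i \<in> restrict U ?I i}" using z U(2) by simp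
      ultimately obtain g where "g \<in> S - C n" "\<forall>i\<in>?I. act g (z i) \<in> Z \<inter> restrict U ?I i"
        unfolding A_def by blast
      then have g: "g \<notin> C n" "\<And>i. i \<in> ?I \<Longrightarrow> act g (z i) \<in> Z" "\<And>i. i \<in> ?I \<Longrightarrow> act g (z i) \<in> U i"
        by auto
      have "dist (act g (z i)) (z i) < 1 / Suc n" if "i \<in> ?I" for i
        using subsetD[OF U(3) g(3)[OF that]] by (simp add: dist_commute)
      then show ?thesis
        using g(1,2) by blast
    qed
    then obtain g where g: "\<And>n. g n \<notin> C n"
        "\<And>n i. i \<in> ?I \<Longrightarrow> act (g n) (z i) \<in> Z"
        "\<And>n i. i \<in> ?I \<Longrightarrow> dist (act (g n) (z i)) (z i) < 1 / Suc n"
      by metis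
    have "tends_to_group_infinity g"
      unfolding tends_to_group_infinity_def eventually_sequentially
    proof (intro allI impI)
      fix K :: "'g set" assume "compact K"
      from C(2)[OF this] obtain N where "\<forall>n\<ge>N. K \<subseteq> C n" ..
      then have "\<forall>n\<ge>N. g n \<notin> K" using g(1) by auto
      then show "\<exists>N. \<forall>n\<ge>N. g n \<notin> K" ..
    qed
    moreover have "(\<lambda>n. act (g n) (z i)) \<longlonglongrightarrow> z i" if "i \<in> ?I" for i
    proof (rule tendsto_dist_iff[THEN iffD2], rule tendsto_sandwich[OF _ _ tendsto_const LIMSEQ_inverse_real_of_nat])
      show "\<forall>\<^sub>F n in sequentially. dist (act (g n) (z i)) (z i) \<le> inverse (real (Suc n))"
        using g(3)[OF that] by (auto simp: inverse_eq_divide less_imp_le)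
    qed auto
    ultimately show "\<exists>g. tends_to_group_infinity g \<and>
         (\<forall>j\<in>?I. (\<forall>n. act (g n) (z j) \<in> Z) \<and> (\<lambda>n. act (g n) (z j)) \<longlonglongrightarrow> z j)"
      using g(2) by blast
  qed
qed

end
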